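(* Let $m \geq 3$ and $r_1, \dots, r_m \geq 3$, and let $G$ be a complete $m$-partite graph $K_{r_1,\dots,r_m}$ (with labeled vertex set $V$). Then for every integer $k$ with $2 \leq k \leq \min\{r_1,\dots,r_m\}$, $G$ is uniquely reconstructible from $T_k(G)$ among complete multipartite graphs: if $G'$ is a complete multipartite graph on the vertex set $V$ with $T_k(G') = T_k(G)$, then $G' = G$.
   Context: Graphs are finite, simple, labeled; two labeled graphs are equal if they have the same vertex set and the same edge set. For $k \geq 2$, $T_k(G) = \{X \subseteq V(G) : |X| = k \text{ and the subgraph of } G \text{ induced by } X \text{ is connected}\}$. *)

theory Defs
  imports "HOL-Library.Disjoint_Sets" "Graph_Theory.Graph_Theory"
begin

text \<open>
  A finite simple labelled graph is a \<^locale>\<open>pair_graph\<close>: finitely many vertices, and a symmetric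
  irreflexive set of ordered pairs, each edge being present in both directions.
  Equality of \<^typ>\<open>'a pair_pre_digraph\<close> records is therefore equality of labelled graphs.
\<close>

definition complete_partite ::
    "nat \<Rightarrow> (nat \<Rightarrow> nat) \<Rightarrow> 'a pair_pre_digraph \<Rightarrow> bool" where
  "complete_partite m r G \<longleftrightarrow> pair_graph G \<and>
     (\<exists>P. pverts G = (\<Union>i\<in>{1..m}. P i) \<and> disjoint_family_on P {1..m} \<and>
          (\<forall>i\<in>{1..m}. card (P i) = r i) \<and>
          parcs G = {(u, v). \<exists>i\<in>{1..m}. \<exists>j\<in>{1..m}. i \<noteq> j \<and> u \<in> P i \<and> v \<in> P j})"

text \<open>
  The number of parts is arbitrary; parts are nonempty. A single part, i.e. an edgeless graph,
  is allowed.
\<close>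

definition complete_multipartite :: "'a pair_pre_digraph \<Rightarrow> bool" where
  "complete_multipartite G \<longleftrightarrow>
     (\<exists>m r. 1 \<le> m \<and> (\<forall>i\<in>{1..m}. 1 \<le> r i) \<and> complete_partite m r G)"

definition connected_ksets :: "nat \<Rightarrow> 'a pair_pre_digraph \<Rightarrow> 'a set set" where
  "connected_ksets k G =
     {X. X \<subseteq> pverts G \<and> card X = k \<and> connected (with_proj G \<restriction> X)}"

end

theory Submission
  imports Defs
begin

text \<open>
  A set of at least two vertices of a complete multipartite graph is disconnected iff it lies
  inside one part, that is, iff it is independent. As every part of \<open>G\<close> has at least \<open>k\<close> vertices,
  two vertices in a common part of \<open>G\<close> lie in a disconnected \<open>k\<close>-set, so they are nonadjacent
  in \<open>G'\<close> as well. Hence the parts of \<open>G'\<close> are unions of parts of \<open>G\<close>, so they too have at least \<open>k\<close>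
  vertices, and the same argument with the roles exchanged shows that the graphs are equal.
\<close>

text \<open>
  Complete multipartite graphs enter only through the transitivity of nonadjacency, which makes
  the parts the classes \<open>{w. (u, w) \<notin> parcs G}\<close>.
\<close>

locale multipartite_graph = pair_graph +
  assumes nonadj_trans:
    "\<lbrakk>u \<in> pverts G; v \<in> pverts G; w \<in> pverts G; (u, v) \<notin> parcs G; (v, w) \<notin> parcs G\<rbrakk>
      \<Longrightarrow> (u, w) \<notin> parcs G"

text \<open>Trades the family of parts for the map \<open>p\<close> sending a vertex to the index of
  its part, well defined by disjointness. Adjacency becomes \<open>p u \<noteq> p v\<close>, so
  transitivity of nonadjacency is that of equality.\<close>

lemma complete_partiteE:
  assumes "complete_partite m r G"
  obtains p where "pair_graph G" "p ` pverts G \<subseteq> {1..m}"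
    "parcs G = {(u, v). u \<in> pverts G \<and> v \<in> pverts G \<and> p u \<noteq> p v}"
    "\<And>i. i \<in> {1..m} \<Longrightarrow> card {u \<in> pverts G. p u = i} = r i"
proof -
  from assms obtain P where G: "pair_graph G"
    and V: "pverts G = (\<Union>i\<in>{1..m}. P i)"
    and disj: "disjoint_family_on P {1..m}"
    and card: "\<forall>i\<in>{1..m}. card (P i) = r i"
    and E: "parcs G = {(u, v). \<exists>i\<in>{1..m}. \<exists>j\<in>{1..m}. i \<noteq> j \<and> u \<in> P i \<and> v \<in> P j}"
    unfolding complete_partite_def by blast
  define p where "p u = (THE i. i \<in> {1..m} \<and> u \<in> P i)" for u
  have p: "p u = i" if "i \<in> {1..m}" "u \<in> P i" for u i
    unfolding p_def using that disj unfolding disjoint_family_on_def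
    by (intro the_equality) blast+
  have P: "u \<in> P i \<longleftrightarrow> u \<in> pverts G \<and> p u = i" if "i \<in> {1..m}" for u i
    using p that unfolding V by blast
  show thesis
  proof
    show pV: "p ` pverts G \<subseteq> {1..m}"
      using p unfolding V by blast
    have "(u, v) \<in> parcs G \<longleftrightarrow> u \<in> pverts G \<and> v \<in> pverts G \<and> p u \<noteq> p v" for u v
    proof -
      have "(u, v) \<in> parcs G \<longleftrightarrow> (\<exists>i\<in>{1..m}. \<exists>j\<in>{1..m}. i \<noteq> j \<and> u \<in> P i \<and> v \<in> P j)"
        by (simp add: E)
      also have "\<dots> \<longleftrightarrow> (\<exists>i\<in>{1..m}. \<exists>j\<in>{1..m}. i \<noteq> j \<and>
          (u \<in> pverts G \<and> p u = i) \<and> (v \<in> pverts G \<and> p v = j))"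
        by (intro bex_cong refl) (simp only: P)
      also have "\<dots> \<longleftrightarrow> u \<in> pverts G \<and> v \<in> pverts G \<and> p u \<noteq> p v"
        using pV by blast
      finally show ?thesis .
    qed
    then show "parcs G = {(u, v). u \<in> pverts G \<and> v \<in> pverts G \<and> p u \<noteq> p v}"
      by auto
    show "card {u \<in> pverts G. p u = i} = r i" if "i \<in> {1..m}" for i
    proof -
      have "{u \<in> pverts G. p u = i} = P i"
        using P[OF that] by blast
      with card that show ?thesis by simp
    qed
  qed (fact G)
qed

lemma complete_partite_imp_multipartite_graph:
  assumes "complete_partite m r G"
  shows "multipartite_graph G"
  using assms
  by (rule complete_partiteE) (simp add: multipartite_graph_def multipartite_graph_axioms_def)

text \<open>The nonneighbours of \<open>u\<close>, with \<open>u\<close> itself among them, form its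
  part. This turns a lower bound on the \<open>r i\<close> into one on nonneighbour classes.\<close>

lemma complete_partite_card_nonneighbours:
  assumes "complete_partite m r G" and "u \<in> pverts G"
  shows "\<exists>i\<in>{1..m}. card {w \<in> pverts G. (u, w) \<notin> parcs G} = r i"
  using assms(1)
proof (rule complete_partiteE)
  fix p
  assume p: "p ` pverts G \<subseteq> {1..m}"
    and E: "parcs G = {(u, v). u \<in> pverts G \<and> v \<in> pverts G \<and> p u \<noteq> p v}"
    and card: "\<And>i. i \<in> {1..m} \<Longrightarrow> card {u \<in> pverts G. p u = i} = r i"
  have "{w \<in> pverts G. (u, w) \<notin> parcs G} = {w \<in> pverts G. p w = p u}"
    using assms(2) by (auto simp: E)
  moreover have "p u \<in> {1..m}"
    using p assms(2) by blast
  ultimately show ?thesis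
    using card by auto
qed

context multipartite_graph
begin

text \<open>Given an edge \<open>(u, v)\<close> inside \<open>X\<close>, a vertex of
  \<open>X\<close> nonadjacent to \<open>u\<close> must be adjacent to \<open>v\<close>, so every
  vertex of \<open>X\<close> is within distance two of \<open>u\<close>.\<close>

lemma connected_induce_iff:
  assumes "X \<subseteq> pverts G" and "2 \<le> card X"
  shows "connected (with_proj G \<restriction> X) \<longleftrightarrow> (\<exists>u\<in>X. \<exists>v\<in>X. (u, v) \<in> parcs G)"
proof -
  \<comment> \<open>\<open>connected\<close> is strong connectivity of the symmetric closure. As
    \<open>G\<close> is symmetric, the closure adds no arcs.\<close>
  define S where "S = mk_symmetric (with_proj G \<restriction> X)"
  have "wf_digraph (with_proj G \<restriction> X)"
    by (intro wellformed_induce_subgraph)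
  then interpret S: pair_wf_digraph S
    unfolding S_def by (rule wf_digraph.wellformed_mk_symmetric)
  have V: "pverts S = X"
    by (simp add: S_def)
  have E: "(u, v) \<in> parcs S \<longleftrightarrow> u \<in> X \<and> v \<in> X \<and> (u, v) \<in> parcs G" for u v
    using arcs_symmetric by (auto simp: S_def parcs_mk_symmetric)
  have conn: "connected (with_proj G \<restriction> X) \<longleftrightarrow> X \<noteq> {} \<and> (\<forall>u\<in>X. \<forall>v\<in>X. u \<rightarrow>\<^sup>*\<^bsub>S\<^esub> v)"
    by (simp add: connected_def strongly_connected_def V flip: S_def)
  show ?thesis
  proof
    assume "connected (with_proj G \<restriction> X)"
    \<comment> \<open>The bound on \<open>card X\<close> enters here: a single vertex is connected
      without any edge.\<close>
    moreover obtain x y where "x \<in> X" "y \<in> X" "x \<noteq> y"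
      using assms(2) by (metis card_2_iff' obtain_subset_with_card_n subset_iff)
    ultimately have "x \<rightarrow>\<^sup>*\<^bsub>S\<^esub> y"
      by (simp add: conn)
    then show "\<exists>u\<in>X. \<exists>v\<in>X. (u, v) \<in> parcs G"
      \<comment> \<open>Only the first arc of a walk from \<open>x\<close> to \<open>y\<close>
        matters; the empty walk is ruled out by \<open>x \<noteq> y\<close>.\<close>
      using \<open>x \<noteq> y\<close> by (induct rule: S.converse_reachable_induct) (auto simp: E)
  next
    assume "\<exists>u\<in>X. \<exists>v\<in>X. (u, v) \<in> parcs G"
    then obtain u v where uv: "u \<in> X" "v \<in> X" "(u, v) \<in> parcs G" by blast
    have adj: "a \<rightarrow>\<^sup>*\<^bsub>S\<^esub> b" if "a \<in> X" "b \<in> X" "(a, b) \<in> parcs G" for a b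
      using that E by (auto intro: S.reachable_adjI)
    have reach: "u \<rightarrow>\<^sup>*\<^bsub>S\<^esub> w \<and> w \<rightarrow>\<^sup>*\<^bsub>S\<^esub> u" if w: "w \<in> X" for w
    proof (cases "(u, w) \<in> parcs G")
      case True
      then show ?thesis using adj uv(1) w arcs_symmetric by blast
    next
      case False
      then have "(w, v) \<in> parcs G"
        using nonadj_trans[of u w v] uv w assms(1) by blast
      then have "v \<rightarrow>\<^sup>*\<^bsub>S\<^esub> w" "w \<rightarrow>\<^sup>*\<^bsub>S\<^esub> v" "u \<rightarrow>\<^sup>*\<^bsub>S\<^esub> v" "v \<rightarrow>\<^sup>*\<^bsub>S\<^esub> u"
        using adj uv w arcs_symmetric by blast+
      then show ?thesis using S.reachable_trans by blast
    qed
    have "a \<rightarrow>\<^sup>*\<^bsub>S\<^esub> b" if "a \<in> X" "b \<in> X" for a b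
      using reach[OF that(1)] reach[OF that(2)] S.reachable_trans by blast
    with uv(1) show "connected (with_proj G \<restriction> X)"
      by (auto simp: conn)
  qed
qed

lemma connected_ksets_eq:
  assumes "2 \<le> k"
  shows "connected_ksets k G =
    {X. X \<subseteq> pverts G \<and> card X = k \<and> (\<exists>u\<in>X. \<exists>v\<in>X. (u, v) \<in> parcs G)}"
  unfolding connected_ksets_def using assms connected_induce_iff by (intro Collect_cong) blast

text \<open>The nonneighbour class of \<open>u\<close> is independent and contains \<open>u\<close>
  and \<open>v\<close>. Its size allows \<open>{u, v}\<close> to be padded to \<open>k\<close>
  vertices inside it.\<close>

lemma nonadj_imp_disconnected_kset:
  assumes "2 \<le> k" and "u \<in> pverts G" and "v \<in> pverts G" and "(u, v) \<notin> parcs G"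
    and "k \<le> card {w \<in> pverts G. (u, w) \<notin> parcs G}"
  obtains X where "u \<in> X" "v \<in> X" "X \<subseteq> pverts G" "card X = k" "X \<notin> connected_ksets k G"
proof -
  have fin: "finite {w \<in> pverts G. (u, w) \<notin> parcs G}"
    using pair_finite_verts by simp
  \<comment> \<open>Only an inequality, since \<open>u = v\<close> is allowed.\<close>
  have "card {u, v} \<le> k"
    using assms(1) by (simp add: card_insert_if)
  moreover have "{u, v} \<subseteq> {w \<in> pverts G. (u, w) \<notin> parcs G}"
    using assms(2-4) no_loops' by auto
  ultimately obtain X where X: "{u, v} \<subseteq> X" "X \<subseteq> {w \<in> pverts G. (u, w) \<notin> parcs G}" "card X = k"
    using exists_subset_between[OF _ assms(5) _ fin] by blast
  have "(a, b) \<notin> parcs G" if "a \<in> X" "b \<in> X" for a b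
    using nonadj_trans[of a u b] assms(2) X(2) that arcs_symmetric by blast
  then have "X \<notin> connected_ksets k G"
    using assms(1) by (auto simp: connected_ksets_eq)
  with X show thesis by (intro that) auto
qed

end

text \<open>One inclusion at a time, with the size bound on \<open>G\<close> only, so that it can be
  applied again with the two graphs exchanged.\<close>

lemma parcs_subset_if_connected_ksets_subset:
  assumes "multipartite_graph G" and "multipartite_graph H"
    and "pverts H = pverts G" and "2 \<le> k"
    and "connected_ksets k H \<subseteq> connected_ksets k G"
    and "\<And>u. u \<in> pverts G \<Longrightarrow> k \<le> card {w \<in> pverts G. (u, w) \<notin> parcs G}"
  shows "parcs H \<subseteq> parcs G"
proof (rule subrelI, rule ccontr)
  interpret G: multipartite_graph G by fact
  interpret H: multipartite_graph H by fact
  fix u v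
  assume uv: "(u, v) \<in> parcs H" "(u, v) \<notin> parcs G"
  have "u \<in> pverts G" "v \<in> pverts G"
    using uv(1) H.in_arcsD1 H.in_arcsD2 assms(3) by auto
  then obtain X where "u \<in> X" "v \<in> X" "X \<subseteq> pverts G" "card X = k" "X \<notin> connected_ksets k G"
    using G.nonadj_imp_disconnected_kset[OF assms(4) _ _ uv(2) assms(6)] by blast
  \<comment> \<open>The arc \<open>(u, v)\<close> of \<open>H\<close> lies inside
    \<open>X\<close>.\<close>
  moreover from this have "X \<in> connected_ksets k H"
    using uv(1) assms(3,4) by (auto simp: H.connected_ksets_eq)
  ultimately show False using assms(5) by blast
qed

theorem theorem2p3:
  fixes G :: "'a pair_pre_digraph" and m k :: nat and r :: "nat \<Rightarrow> nat"
  assumes "3 \<le> m"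
    and "\<forall>i\<in>{1..m}. 3 \<le> r i"
    and "complete_partite m r G"
    and "2 \<le> k"
    and "k \<le> Min (r ` {1..m})"
  shows "\<forall>G'. complete_multipartite G' \<and> pverts G' = pverts G \<and>
               connected_ksets k G' = connected_ksets k G \<longrightarrow> G' = G"
proof (intro allI impI, elim conjE)
  fix G' :: "'a pair_pre_digraph"
  assume "complete_multipartite G'" and V: "pverts G' = pverts G"
    and T: "connected_ksets k G' = connected_ksets k G"
  have G: "multipartite_graph G" and G': "multipartite_graph G'"
    using assms(3) \<open>complete_multipartite G'\<close> complete_partite_imp_multipartite_graph
    unfolding complete_multipartite_def by blast+
  interpret G: multipartite_graph G by (fact G)
  have large: "k \<le> card {w \<in> pverts G. (u, w) \<notin> parcs G}" if u: "u \<in> pverts G" for u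
  proof -
    obtain i where "i \<in> {1..m}" "card {w \<in> pverts G. (u, w) \<notin> parcs G} = r i"
      using complete_partite_card_nonneighbours[OF assms(3) u] by blast
    with assms(5) show ?thesis by simp
  qed
  have sub: "parcs G' \<subseteq> parcs G"
    using parcs_subset_if_connected_ksets_subset[OF G G' V assms(4) _ large] T by simp
  \<comment> \<open>The sizes of the parts of \<open>G'\<close> are not given. Having no arcs
    outside \<open>G\<close>, it has nonneighbour classes at least as large, which carries the bound
    over.\<close>
  have large': "k \<le> card {w \<in> pverts G'. (u, w) \<notin> parcs G'}" if "u \<in> pverts G'" for u
  proof -
    have "card {w \<in> pverts G. (u, w) \<notin> parcs G} \<le> card {w \<in> pverts G'. (u, w) \<notin> parcs G'}"
      using sub V G.pair_finite_verts by (intro card_mono) auto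
    with large[of u] that V show ?thesis by simp
  qed
  have "parcs G \<subseteq> parcs G'"
    using parcs_subset_if_connected_ksets_subset[OF G' G V[symmetric] assms(4) _ large'] T by simp
  with sub V show "G' = G" by simp
qed

end
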